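(* Let $n\ge 1$ be a natural number, let $\alpha$ be the only solution of the equation $$\tan(\alpha\log(n+1))+2\alpha=0$$ in the interval $\left(\frac{\pi}{2\log(n+1)},\frac{\pi}{\log(n+1)}\right)$, and let $$h(x)=x^{-1/2}\left(2\alpha\cos(\alpha\log x)+\sin(\alpha\log x)\right),\qquad 1\le x\le n+1.$$ Define $$a_k=\int_k^{k+1}h(x)\,dx,\qquad k=1,2,\dots,n.$$ Then $$\sum_{k=1}^{n}\left(\frac{1}{k}\sum_{j=1}^{k}a_j\right)^2\geq \frac{4}{1+4\alpha^2}\sum_{k=1}^{n}a_k^2.$$
   Context: $\log$ denotes the natural logarithm. *)

theory Defs
  imports "HOL-Analysis.Analysis"
begin

(* The endpoint pi / (2 log(n+1)), where tan has a pole (and the library's tan is 0 by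
   convention), is excluded, so tan takes its genuine value on the whole interval. *)
definition alpha_solution :: "nat \<Rightarrow> real \<Rightarrow> bool" where
  "alpha_solution n \<alpha> \<longleftrightarrow>
     \<alpha> \<in> {pi / (2 * ln (real n + 1)) <..< pi / ln (real n + 1)} \<and>
     tan (\<alpha> * ln (real n + 1)) + 2 * \<alpha> = 0"

(* Only the values for 1 \<le> x \<le> n + 1 are ever used. *)
definition h :: "real \<Rightarrow> real \<Rightarrow> real" where
  "h \<alpha> x = x powr (-1/2) * (2 * \<alpha> * cos (\<alpha> * ln x) + sin (\<alpha> * ln x))"

definition a :: "real \<Rightarrow> nat \<Rightarrow> real" where
  "a \<alpha> k = integral {real k .. real k + 1} (h \<alpha>)"

end

theory Submission
  imports Defs
begin

text \<open>The function \<open>H x = 2 \<surd>x sin (\<alpha> ln x)\<close> is the primitive of \<open>h\<close> vanishing at 1, so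
  \<open>a\<^sub>1 + \<dots> + a\<^sub>k = H (k + 1)\<close>. The equation for \<open>\<alpha>\<close> makes \<open>h\<close> nonnegative on \<open>[1, n + 1]\<close> with
  \<open>h (n + 1) = 0\<close>, so \<open>H\<close> increases and \<open>(H x / x)\<^sup>2 \<le> (H (k + 1) / k)\<^sup>2\<close> on \<open>[k, k + 1]\<close>, while
  \<open>a\<^sub>k\<^sup>2 \<le> \<integral> h\<^sup>2\<close> there. It remains that \<open>(H x / x)\<^sup>2 - 4 / (1 + 4 \<alpha>\<^sup>2) h\<^sup>2\<close> has integral 0 over
  \<open>[1, n + 1]\<close>: its primitive is a multiple of \<open>sin \<theta> (2 \<alpha> cos \<theta> + sin \<theta>)\<close> with
  \<open>\<theta> = \<alpha> ln x\<close>, which vanishes at both ends.\<close>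

text \<open>Shifting by the period pi moves both points into (-pi/2, 0), a branch on which tan
  increases.\<close>

lemma tan_strict_mono_second_quadrant:
  fixes x y :: real
  assumes "pi / 2 < x" "x < y" "y < pi"
  shows "tan x < tan y"
proof -
  have "tan (x - pi) < tan (y - pi)"
    by (rule tan_monotone) (use assms in auto)
  moreover have "tan (z - pi) = tan z" for z :: real
    by (simp add: tan_def)
  ultimately show ?thesis by simp
qed

lemma cos_neg_second_quadrant:
  fixes x :: real
  assumes "pi / 2 < x" "x < pi"
  shows "cos x < 0"
  using cos_gt_zero_pi[of "pi - x"] assms by simp

lemma alpha_solutionD:
  assumes "n \<ge> 1" "alpha_solution n \<alpha>"
  shows "0 < \<alpha>" "pi / 2 < \<alpha> * ln (real n + 1)" "\<alpha> * ln (real n + 1) < pi"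
    "tan (\<alpha> * ln (real n + 1)) = - 2 * \<alpha>"
proof -
  have L: "ln (real n + 1) > 0" using assms(1) by simp
  have lo: "pi / (2 * ln (real n + 1)) < \<alpha>" and hi: "\<alpha> < pi / ln (real n + 1)"
    and eq: "tan (\<alpha> * ln (real n + 1)) + 2 * \<alpha> = 0"
    using assms(2) by (auto simp: alpha_solution_def)
  have "0 < pi / (2 * ln (real n + 1))" using L by simp
  with lo show "0 < \<alpha>" by linarith
  show "pi / 2 < \<alpha> * ln (real n + 1)" "\<alpha> * ln (real n + 1) < pi"
    using lo hi L by (auto simp: field_simps)
  show "tan (\<alpha> * ln (real n + 1)) = - 2 * \<alpha>" using eq by linarith
qed

lemma ex_alpha_solution:
  assumes "n \<ge> 1"
  shows "\<exists>\<alpha>. alpha_solution n \<alpha>"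
proof -
  define L where "L = ln (real n + 1)"
  have L: "L > 0" using assms by (simp add: L_def)
  \<comment> \<open>The equation multiplied by the cosine: unlike tan, \<open>F\<close> is
    continuous at the left endpoint, so the intermediate value theorem applies on the closed
    interval.\<close>
  define F where "F t = sin (t * L) + 2 * t * cos (t * L)" for t
  have le: "pi / (2 * L) \<le> pi / L" using L by (simp add: field_simps)
  have Fl: "F (pi / (2 * L)) = 1" and Fr: "F (pi / L) < 0"
    using L by (simp_all add: F_def)
  have "continuous_on {pi / (2 * L)..pi / L} F"
    unfolding F_def by (intro continuous_intros)
  then obtain t where t: "pi / (2 * L) \<le> t" "t \<le> pi / L" "F t = 0"
    using IVT2'[of F "pi / L" 0 "pi / (2 * L)"] Fl Fr le by auto
  have "t \<noteq> pi / (2 * L)" "t \<noteq> pi / L" using t(3) Fl Fr by auto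
  with t have lo: "pi / (2 * L) < t" and hi: "t < pi / L" by auto
  have "pi / 2 < t * L" "t * L < pi" using lo hi L by (auto simp: field_simps)
  then have "cos (t * L) < 0" using cos_neg_second_quadrant[of "t * L"] by simp
  then have "tan (t * L) + 2 * t = 0" using t(3) by (simp add: F_def tan_def field_simps)
  then show ?thesis using lo hi by (auto simp: alpha_solution_def L_def)
qed

text \<open>For solutions \<open>x < y\<close>, tan at \<open>x * ln (real n + 1)\<close> would be
  the smaller value, yet these values are -2x > -2y.\<close>

lemma alpha_solution_unique:
  assumes "n \<ge> 1" "alpha_solution n \<alpha>" "alpha_solution n \<beta>"
  shows "\<alpha> = \<beta>"
proof -
  have L: "ln (real n + 1) > 0" using assms(1) by simp
  have "\<not> x < y" if "alpha_solution n x" "alpha_solution n y" for x y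
  proof
    assume "x < y"
    with L have "x * ln (real n + 1) < y * ln (real n + 1)" by simp
    from tan_strict_mono_second_quadrant[OF _ this]
    show False
      using alpha_solutionD[OF assms(1) that(1)] alpha_solutionD[OF assms(1) that(2)] \<open>x < y\<close>
      by simp
  qed
  with assms show ?thesis by (meson linorder_neqE_linordered_idom)
qed

text \<open>Up to pi/2 both summands are nonnegative. Beyond it, monotonicity gives tan \<theta>
  \<le> tan \<phi> = -2 \<alpha>, and multiplying by the negative cosine reverses this.\<close>

lemma h_trig_factor_nonneg:
  assumes "0 < \<alpha>" "\<phi> < pi" "tan \<phi> = - 2 * \<alpha>" "0 \<le> \<theta>" "\<theta> \<le> \<phi>"
  shows "0 \<le> 2 * \<alpha> * cos \<theta> + sin \<theta>"
proof (cases "\<theta> \<le> pi / 2")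
  case True
  then show ?thesis
    using assms by (intro add_nonneg_nonneg mult_nonneg_nonneg cos_ge_zero sin_ge_zero) auto
next
  case False
  have "tan \<theta> \<le> - 2 * \<alpha>"
    using tan_strict_mono_second_quadrant[of \<theta> \<phi>] assms False by (cases "\<theta> = \<phi>") auto
  moreover have "cos \<theta> < 0"
    using cos_neg_second_quadrant[of \<theta>] assms False by simp
  ultimately show ?thesis by (simp add: tan_def field_simps)
qed

definition H :: "real \<Rightarrow> real \<Rightarrow> real" where
  "H \<alpha> x = 2 * sqrt x * sin (\<alpha> * ln x)"

lemma h_eq:
  assumes "x > 0"
  shows "h \<alpha> x = (2 * \<alpha> * cos (\<alpha> * ln x) + sin (\<alpha> * ln x)) / sqrt x"
proof -
  have "x powr (-1/2) = inverse (sqrt x)"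
    using assms powr_minus[of x "1/2"] by (simp add: powr_half_sqrt)
  then show ?thesis by (simp add: h_def field_simps)
qed

lemma H_has_field_derivative:
  assumes "x > 0"
  shows "(H \<alpha> has_field_derivative h \<alpha> x) (at x within S)"
proof -
  let ?s = "sin (\<alpha> * ln x)" and ?c = "cos (\<alpha> * ln x)"
  have "((\<lambda>x. sin (\<alpha> * ln x)) has_field_derivative ?c * (\<alpha> / x)) (at x within S)"
    using assms by (auto intro!: derivative_eq_intros)
  moreover have "((\<lambda>x. 2 * sqrt x) has_field_derivative 2 * (inverse (sqrt x) / 2)) (at x within S)"
    using assms by (intro DERIV_cmult has_field_derivative_at_within[OF DERIV_real_sqrt])
  ultimately have "(H \<alpha> has_field_derivative
      (2 * (inverse (sqrt x) / 2)) * ?s + ?c * (\<alpha> / x) * (2 * sqrt x)) (at x within S)"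
    unfolding H_def by (intro DERIV_mult)
  \<comment> \<open>Writing q for \<open>sqrt x\<close> and q * q for x turns the claim into a
    rational identity.\<close>
  moreover have "(2 * (inverse q / 2)) * u + w * (\<alpha> / (q * q)) * (2 * q) = (2 * \<alpha> * w + u) / q"
    if "q \<noteq> 0" for q u w :: real
    using that by (simp add: field_simps)
  from this[of "sqrt x" ?s ?c]
  have "(2 * (inverse (sqrt x) / 2)) * ?s + ?c * (\<alpha> / x) * (2 * sqrt x) = h \<alpha> x"
    using assms by (simp add: h_eq)
  ultimately show ?thesis by (simp only:)
qed

lemma h_has_integral:
  assumes "0 < u" "u \<le> v"
  shows "(h \<alpha> has_integral (H \<alpha> v - H \<alpha> u)) {u..v}"
  using assms
  by (intro fundamental_theorem_of_calculus)
     (auto simp flip: has_real_derivative_iff_has_vector_derivative intro: H_has_field_derivative)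

lemma a_eq: "k \<ge> 1 \<Longrightarrow> a \<alpha> k = H \<alpha> (real k + 1) - H \<alpha> (real k)"
  unfolding a_def by (rule integral_unique[OF h_has_integral]) auto

lemma sum_a_eq: "(\<Sum>j=1..k. a \<alpha> j) = H \<alpha> (real k + 1)"
proof (induction k)
  case 0
  show ?case by (simp add: H_def)
next
  case (Suc k)
  then show ?case by (simp add: a_eq add.commute)
qed

definition hardy_gap_primitive :: "real \<Rightarrow> real \<Rightarrow> real" where
  "hardy_gap_primitive \<alpha> x = - 8 / (1 + 4 * \<alpha>\<^sup>2) *
     (sin (\<alpha> * ln x) * (2 * \<alpha> * cos (\<alpha> * ln x) + sin (\<alpha> * ln x)))"

text \<open>With \<theta> = \<alpha> ln x, the factor \<open>4 / (1 + 4 * \<alpha>\<^sup>2)\<close>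
  equalizes the means over a period of 4 sin\<theta> squared and of the scaled square of 2 \<alpha>
  cos\<theta> + sin\<theta>. Hence the primitive has no term proportional to ln x.\<close>

lemma hardy_gap_primitive_has_field_derivative:
  assumes "x > 0"
  shows "(hardy_gap_primitive \<alpha> has_field_derivative
    ((H \<alpha> x / x)\<^sup>2 - 4 / (1 + 4 * \<alpha>\<^sup>2) * (h \<alpha> x)\<^sup>2)) (at x within S)"
proof -
  define s c where "s = sin (\<alpha> * ln x)" and "c = cos (\<alpha> * ln x)"
  have pos: "1 + 4 * \<alpha>\<^sup>2 > 0" by (simp add: add_pos_nonneg)
  have "(H \<alpha> x / x)\<^sup>2 = 4 * (sqrt x)\<^sup>2 * s\<^sup>2 / x\<^sup>2"
    by (simp add: H_def s_def power_mult_distrib power_divide)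
  then have H_sq: "(H \<alpha> x / x)\<^sup>2 = 4 * s\<^sup>2 / x"
    using assms by (simp add: power2_eq_square)
  have h_sq: "(h \<alpha> x)\<^sup>2 = (2 * \<alpha> * c + s)\<^sup>2 / x"
    using assms by (simp add: h_eq s_def c_def power_divide)
  have "(H \<alpha> x / x)\<^sup>2 - 4 / (1 + 4 * \<alpha>\<^sup>2) * (h \<alpha> x)\<^sup>2 =
      - 8 / (1 + 4 * \<alpha>\<^sup>2) * ((\<alpha> / x) * (c * (2 * \<alpha> * c + s) + s * (c - 2 * \<alpha> * s)))"
    unfolding H_sq h_sq using pos assms by (simp add: divide_simps) (simp add: algebra_simps power2_eq_square)
  moreover have "((\<lambda>x. sin (\<alpha> * ln x) * (2 * \<alpha> * cos (\<alpha> * ln x) + sin (\<alpha> * ln x)))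
      has_field_derivative (\<alpha> / x) * (c * (2 * \<alpha> * c + s) + s * (c - 2 * \<alpha> * s))) (at x within S)"
    unfolding s_def c_def using assms
    by (auto intro!: derivative_eq_intros simp: divide_inverse algebra_simps)
  ultimately show ?thesis
    unfolding hardy_gap_primitive_def by (simp only: DERIV_cmult)
qed

text \<open>The contribution of one unit interval; the left side telescopes when summed over
  k.\<close>

lemma hardy_gap_le:
  assumes "1 \<le> k" and h_nonneg: "\<And>x. 1 \<le> x \<Longrightarrow> x \<le> real k + 1 \<Longrightarrow> 0 \<le> h \<alpha> x"
  shows "hardy_gap_primitive \<alpha> (real k + 1) - hardy_gap_primitive \<alpha> (real k)
    \<le> (H \<alpha> (real k + 1) / real k)\<^sup>2 - 4 / (1 + 4 * \<alpha>\<^sup>2) * (a \<alpha> k)\<^sup>2"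
proof -
  define C where "C = 4 / (1 + 4 * \<alpha>\<^sup>2)"
  define M where "M = (H \<alpha> (real k + 1) / real k)\<^sup>2"
  have C: "C \<ge> 0" by (simp add: C_def add_nonneg_nonneg)
  have k: "real k \<ge> 1" using assms(1) by simp
  have H_mono: "H \<alpha> u \<le> H \<alpha> v" if "1 \<le> u" "u \<le> v" "v \<le> real k + 1" for u v
    using has_integral_nonneg[OF h_has_integral[of u v \<alpha>]] that h_nonneg by auto
  have gap: "((\<lambda>x. (H \<alpha> x / x)\<^sup>2 - C * (h \<alpha> x)\<^sup>2) has_integral
      (hardy_gap_primitive \<alpha> (real k + 1) - hardy_gap_primitive \<alpha> (real k))) {real k..real k + 1}"
    unfolding C_def
  proof (intro fundamental_theorem_of_calculus)
    fix x assume "x \<in> {real k..real k + 1}"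
    with k have "x > 0" by simp
    then show "(hardy_gap_primitive \<alpha> has_vector_derivative
        (H \<alpha> x / x)\<^sup>2 - 4 / (1 + 4 * \<alpha>\<^sup>2) * (h \<alpha> x)\<^sup>2) (at x within {real k..real k + 1})"
      by (intro hardy_gap_primitive_has_field_derivative
            has_real_derivative_iff_has_vector_derivative[THEN iffD1])
  qed simp
  have ha: "(h \<alpha> has_integral a \<alpha> k) {real k..real k + 1}"
    using h_has_integral[of "real k" "real k + 1" \<alpha>] k a_eq assms(1) by simp
  \<comment> \<open>The interval has length 1, which also makes \<open>a \<alpha> k\<close> the mean
    of \<open>h \<alpha>\<close> on it.\<close>
  have const: "((\<lambda>x. t) has_integral t) {real k..real k + 1}" for t :: real
    using has_integral_const_real[of t "real k" "real k + 1"] by simp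
  \<comment> \<open>\<open>h\<^sup>2\<close> lies above its tangent at the mean value \<open>a \<alpha> k\<close> of \<open>h\<close>; this replaces Jensen's inequality.\<close>
  have bound: "((\<lambda>x. (M + C * (a \<alpha> k)\<^sup>2) - C * (2 * a \<alpha> k) * h \<alpha> x) has_integral
      (M + C * (a \<alpha> k)\<^sup>2) - C * (2 * a \<alpha> k) * a \<alpha> k) {real k..real k + 1}"
    by (intro has_integral_diff const has_integral_mult_right ha)
  have "hardy_gap_primitive \<alpha> (real k + 1) - hardy_gap_primitive \<alpha> (real k)
      \<le> (M + C * (a \<alpha> k)\<^sup>2) - C * (2 * a \<alpha> k) * a \<alpha> k"
  proof (rule has_integral_le[OF gap bound])
    fix x assume x: "x \<in> {real k..real k + 1}"
    \<comment> \<open>Since \<open>H \<alpha> 1 = 0\<close>, monotonicity from 1 onwards gives the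
      sign needed for squaring below.\<close>
    have "0 \<le> H \<alpha> x" using H_mono[of 1 x] x k by (simp add: H_def)
    moreover have "H \<alpha> x \<le> H \<alpha> (real k + 1)" using H_mono x k by simp
    ultimately have "0 \<le> H \<alpha> x / x" "H \<alpha> x / x \<le> H \<alpha> (real k + 1) / real k"
      using x k by (auto intro!: frac_le)
    then have "(H \<alpha> x / x)\<^sup>2 \<le> M" unfolding M_def by (intro power_mono)
    moreover have "0 \<le> C * (h \<alpha> x - a \<alpha> k)\<^sup>2" using C by simp
    ultimately show "(H \<alpha> x / x)\<^sup>2 - C * (h \<alpha> x)\<^sup>2
        \<le> (M + C * (a \<alpha> k)\<^sup>2) - C * (2 * a \<alpha> k) * h \<alpha> x"
      by (simp add: power2_eq_square algebra_simps)
  qed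
  also have "\<dots> = M - C * (a \<alpha> k)\<^sup>2" by (simp add: power2_eq_square algebra_simps)
  finally show ?thesis by (simp add: M_def C_def)
qed

lemma hardy_inequality_alpha_solution:
  assumes "n \<ge> 1" "alpha_solution n \<alpha>"
  shows "4 / (1 + 4 * \<alpha>\<^sup>2) * (\<Sum>k=1..n. (a \<alpha> k)\<^sup>2)
    \<le> (\<Sum>k=1..n. (1 / real k * (\<Sum>j=1..k. a \<alpha> j))\<^sup>2)"
proof -
  let ?G = "hardy_gap_primitive \<alpha>"
  note sol = alpha_solutionD[OF assms]
  have h_nonneg: "0 \<le> h \<alpha> x" if "1 \<le> x" "x \<le> real n + 1" for x
    using h_trig_factor_nonneg[OF sol(1,3,4), of "\<alpha> * ln x"] that sol(1) by (simp add: h_eq)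
  have "cos (\<alpha> * ln (real n + 1)) \<noteq> 0"
    using cos_neg_second_quadrant[of "\<alpha> * ln (real n + 1)"] sol by simp
  then have "2 * \<alpha> * cos (\<alpha> * ln (real n + 1)) + sin (\<alpha> * ln (real n + 1)) = 0"
    using sol(4) by (simp add: tan_def field_simps)
  \<comment> \<open>At 1 the sine factor vanishes because ln 1 = 0; at n + 1 the other factor does,
    by the equation for \<alpha>.\<close>
  then have "0 = ?G (real n + 1) - ?G 1" by (simp add: hardy_gap_primitive_def)
  also have "\<dots> = (\<Sum>k=1..n. ?G (real k + 1) - ?G (real k))"
    using sum_Suc_diff[of 1 n "\<lambda>k. ?G (real k)"] by (simp add: add.commute)
  also have "\<dots> \<le> (\<Sum>k=1..n. (H \<alpha> (real k + 1) / real k)\<^sup>2 - 4 / (1 + 4 * \<alpha>\<^sup>2) * (a \<alpha> k)\<^sup>2)"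
    by (intro sum_mono hardy_gap_le h_nonneg) auto
  finally show ?thesis
    unfolding sum_a_eq by (simp add: sum_subtractf sum_distrib_left)
qed

theorem theorem1p3:
  fixes n :: nat
  assumes "n \<ge> 1"
  shows "(\<exists>!\<alpha>. alpha_solution n \<alpha>) \<and>
    (\<forall>\<alpha>. alpha_solution n \<alpha> \<longrightarrow>
      (\<Sum>k=1..n. (1 / real k * (\<Sum>j=1..k. a \<alpha> j))\<^sup>2)
        \<ge> 4 / (1 + 4 * \<alpha>\<^sup>2) * (\<Sum>k=1..n. (a \<alpha> k)\<^sup>2))"
  using ex_alpha_solution[OF assms] alpha_solution_unique[OF assms]
    hardy_inequality_alpha_solution[OF assms] by blast

end
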